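(* For every integer $n \geq 4$, let $M(n)$ denote the maximum number of directed edges in a critical strongly connected digraph on $n$ vertices. Then $$M(n) = \binom{n}{2} - n + 4.$$
   Context: All digraphs are simple: they have no loops and no multiple edges (two oppositely directed edges $(u,v)$ and $(v,u)$ between the same pair of vertices are allowed). A digraph is strongly connected if every vertex is reachable by a directed path from every other vertex. A digraph $D$ is (vertex-)critical strongly connected if it is strongly connected and, for every vertex $v$, the digraph $D-v$ obtained by deleting $v$ and all edges incident with it is not strongly connected. *)

theory Defs
  imports "Graph_Theory.Digraph_Component"
begin

(* strongly_connected demands a nonempty vertex set, so a one-vertex digraph would be critical
   here; this convention is irrelevant for digraphs with at least two vertices. *)
definition critical_strongly_connected :: "('a, 'b) pre_digraph \<Rightarrow> bool" where
  "critical_strongly_connected D \<longleftrightarrow>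
     strongly_connected D \<and>
     (\<forall>v \<in> verts D. \<not> strongly_connected (pre_digraph.del_vert D v))"

(* The locale digraph is that of finite simple digraphs: no loops, no two arcs with the same tail
   and head, opposite arcs allowed. Every such digraph is isomorphic to one with vertices in nat
   and arcs in nat \<times> nat, so fixing these types loses no generality. *)
definition critical_arc_counts :: "nat \<Rightarrow> nat set" where
  "critical_arc_counts n =
     {card (arcs D) | D :: (nat, nat \<times> nat) pre_digraph.
        digraph D \<and> critical_strongly_connected D \<and> card (verts D) = n}"

lemma finite_critical_arc_counts: "finite (critical_arc_counts n)"
proof (rule finite_subset)
  show "critical_arc_counts n \<subseteq> {..n * n}"
  proof
    fix k assume "k \<in> critical_arc_counts n"
    then obtain D :: "(nat, nat \<times> nat) pre_digraph"
      where D: "digraph D" "card (verts D) = n" "k = card (arcs D)"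
      unfolding critical_arc_counts_def by blast
    interpret digraph D by fact
    have "inj_on (arc_to_ends D) (arcs D)"
      by (rule inj_onI) (rule no_multi_arcs)
    moreover have "arc_to_ends D ` arcs D \<subseteq> verts D \<times> verts D"
      by (auto simp: arc_to_ends_def)
    ultimately have "card (arcs D) \<le> card (verts D \<times> verts D)"
      by (intro card_inj_on_le) auto
    then show "k \<in> {..n * n}"
      using D by (simp add: card_cartesian_product)
  qed
qed simp

definition M :: "nat \<Rightarrow> nat" where
  "M n = Max (critical_arc_counts n)"

end

(* Idea. Call a vertex critical if deleting it destroys strong connectivity. Fix x in a strong
   digraph. A vertex that is a leaf of both a breadth-first in-tree and a breadth-first out-tree
   rooted at x is noncritical, and the numbers of inner vertices of the two trees are bounded by the
   numbers of vertices without an arc to, resp. from, x. Hence deg x plus the number of critical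
   vertices other than x is at most 2(n-1); summing over x bounds the number of arcs in terms of the
   number of noncritical vertices. If only x may be noncritical, deleting x creates at most two new
   noncritical vertices, and induction gives at most (n choose 2) + 1 arcs.

   Now let D be critical, S a largest proper strong vertex set and s = |S|. By maximality a shortest
   ear p_1, ..., p_k of S covers all other vertices, k >= 2 by criticality, and by minimality arcs
   from S enter the ear only at p_1, arcs to S leave it only at p_k, and forward arcs along the ear
   join consecutive vertices. Contracting the ear to one vertex gives a digraph in which (for s >= 2)
   only that vertex may be noncritical, so D has at most
   (s+1 choose 2) + 1 + (k choose 2) + (k-1) arcs, which is at most (n choose 2) - n + 4 since
   (s-2)(k-2) >= 0. If s = 1, there are no backward arcs on the ear and D is a cycle.

   Equality holds for the cycle 0 -> 1 -> ... -> n-1 -> 0 with the arc 1 -> 0 and all backward arcs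
   inside {2..n-1} added. *)
theory Submission
  imports Defs
begin

section \<open>Strong vertex sets of a relation\<close>

text \<open>Only edges of \<open>E\<close> inside \<open>V\<close> count, so deleting a vertex
  amounts to shrinking \<open>V\<close> while \<open>E\<close> stays fixed.\<close>

definition strong_on :: "'a set \<Rightarrow> 'a rel \<Rightarrow> bool" where
  "strong_on V E \<longleftrightarrow> V \<noteq> {} \<and> V \<times> V \<subseteq> (Restr E V)\<^sup>*"

text \<open>The empty set is not strong, so the vertex of a one-element \<open>V\<close> counts as
  critical.\<close>

definition critical_verts :: "'a set \<Rightarrow> 'a rel \<Rightarrow> 'a set" where
  "critical_verts V E = {y \<in> V. \<not> strong_on (V - {y}) E}"

definition in_nbrs :: "'a set \<Rightarrow> 'a rel \<Rightarrow> 'a \<Rightarrow> 'a set" where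
  "in_nbrs V E x = {y \<in> V. (y, x) \<in> E}"

definition out_nbrs :: "'a set \<Rightarrow> 'a rel \<Rightarrow> 'a \<Rightarrow> 'a set" where
  "out_nbrs V E x = {y \<in> V. (x, y) \<in> E}"

lemma strong_onI:
  assumes "r \<in> V" "\<And>v. v \<in> V \<Longrightarrow> (v, r) \<in> (Restr E V)\<^sup>*" "\<And>v. v \<in> V \<Longrightarrow> (r, v) \<in> (Restr E V)\<^sup>*"
  shows "strong_on V E"
  unfolding strong_on_def using assms by (auto intro: rtrancl_trans)

lemma strong_onD:
  assumes "strong_on V E" "u \<in> V" "v \<in> V"
  shows "(u, v) \<in> (Restr E V)\<^sup>*"
  using assms unfolding strong_on_def by auto

lemma rtrancl_Restr_mono:
  assumes "(u, v) \<in> (Restr E V)\<^sup>*" "V \<subseteq> W"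
  shows "(u, v) \<in> (Restr E W)\<^sup>*"
  using assms rtrancl_mono[of "Restr E V" "Restr E W"] by auto

lemma closed_rtrancl:
  assumes "(u, v) \<in> R\<^sup>*" "u \<in> X" "\<And>a b. (a, b) \<in> R \<Longrightarrow> a \<in> X \<Longrightarrow> b \<in> X"
  shows "v \<in> X"
  using assms by (induction rule: rtrancl_induct) auto

lemma strong_on_converse: "strong_on V (E\<inverse>) \<longleftrightarrow> strong_on V E"
proof -
  have "Restr (E\<inverse>) V = (Restr E V)\<inverse>" by auto
  then show ?thesis unfolding strong_on_def by (auto simp: rtrancl_converse)
qed

text \<open>A path from inside \<open>X\<close> to the rest of \<open>V\<close> must leave
  \<open>X\<close> somewhere. This yields edges in strong sets and, read backwards, refutes strength
  by exhibiting a closed \<open>X\<close>.\<close>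

lemma strong_on_exit:
  assumes "strong_on V E" "X \<subseteq> V" "X \<noteq> {}" "X \<noteq> V"
  shows "\<exists>a\<in>X. \<exists>b\<in>V - X. (a, b) \<in> E"
proof -
  obtain u v where uv: "u \<in> X" "v \<in> V - X" using assms by auto
  have "(u, v) \<in> (Restr E V)\<^sup>*" using strong_onD[OF assms(1)] uv assms(2) by auto
  then show ?thesis using closed_rtrancl[of u v "Restr E V" X] uv by blast
qed

section \<open>Breadth-first trees, degrees and noncritical vertices\<close>

text \<open>The set \<open>T\<close> consists of the inner vertices other than \<open>x\<close> of a breadth-first tree directed
  towards the root \<open>x\<close>; each of them has a child, which is not adjacent to \<open>x\<close>.\<close>
lemma in_tree:
  assumes fin: "finite V" and st: "strong_on V E" and x: "x \<in> V"
  shows "\<exists>T. finite T \<and> card T \<le> card {u \<in> V - {x}. (u, x) \<notin> E} \<and>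
    (\<forall>y v. y \<notin> T \<longrightarrow> y \<noteq> x \<longrightarrow> v \<in> V - {y} \<longrightarrow> (v, x) \<in> (Restr E (V - {y}))\<^sup>*)"
proof -
  define U where "U = {u \<in> V - {x}. (u, x) \<notin> E}"
  \<comment> \<open>The distance from \<open>v\<close> to \<open>x\<close> inside
    \<open>V\<close>.\<close>
  define d where "d v = (LEAST n. (v, x) \<in> Restr E V ^^ n)" for v
  have d: "(v, x) \<in> Restr E V ^^ d v" if "v \<in> V" for v
    unfolding d_def using strong_onD[OF st that x] by (auto dest!: rtrancl_imp_relpow intro: LeastI)
  have "\<exists>w. w \<in> V - {x} \<and> (u, w) \<in> E \<and> d w < d u" if "u \<in> U" for u
  proof -
    have u: "u \<in> V" "u \<noteq> x" "(u, x) \<notin> E" using that U_def by auto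
    then obtain m where m: "d u = Suc m" using d[of u] by (cases "d u") auto
    then obtain w where w: "(u, w) \<in> Restr E V" "(w, x) \<in> Restr E V ^^ m"
      using d[of u] u(1) by (metis relpow_Suc_E2)
    have "d w \<le> m" unfolding d_def using w(2) by (rule Least_le)
    with w u m show ?thesis by auto
  qed
  \<comment> \<open>\<open>f u\<close> is the parent of \<open>u\<close> in the tree: the second
    vertex of a shortest path to \<open>x\<close>. It is not \<open>x\<close> because
    \<open>u\<close> has no edge to \<open>x\<close>.\<close>
  then obtain f where f: "\<And>u. u \<in> U \<Longrightarrow> f u \<in> V - {x} \<and> (u, f u) \<in> E \<and> d (f u) < d u"
    by metis
  have finU: "finite U" using fin U_def by auto
  show ?thesis
  proof (intro exI[of _ "f ` U"] conjI allI impI)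
    show "finite (f ` U)" using finU by simp
    show "card (f ` U) \<le> card {u \<in> V - {x}. (u, x) \<notin> E}"
      using card_image_le[OF finU] U_def by simp
    fix y v assume y: "y \<notin> f ` U" "y \<noteq> x" and "v \<in> V - {y}"
    from this(3) show "(v, x) \<in> (Restr E (V - {y}))\<^sup>*"
    \<comment> \<open>Walking up the tree avoids \<open>y\<close>: each step goes directly to
      \<open>x\<close> or to a parent \<open>f v\<close>, and \<open>y\<close> is no such
      parent.\<close>
    proof (induction "d v" arbitrary: v rule: less_induct)
      case less
      consider "v = x" | "v \<noteq> x" "(v, x) \<in> E" | "v \<in> U" using less.prems U_def by auto
      then show ?case
      proof cases
        case 2
        then show ?thesis using less.prems x y by (intro r_into_rtrancl) auto
      next
        case 3
        then have *: "f v \<in> V - {y}" "(v, f v) \<in> E" "d (f v) < d v" using f y(1) by auto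
        then have "(v, f v) \<in> Restr E (V - {y})" using less.prems by auto
        then show ?thesis using less.hyps[OF *(3,1)] by (rule converse_rtrancl_into_rtrancl)
      qed simp
    qed
  qed
qed

text \<open>Take a tree towards \<open>x\<close> for \<open>E\<close> and one for its converse. If
  \<open>y\<close> is an inner vertex of neither, both trees still link all remaining vertices with
  \<open>x\<close>, so \<open>y\<close> is noncritical. The inner vertices of each tree are at most
  as many as the non-neighbours of \<open>x\<close> in that direction.\<close>

lemma card_critical_degree:
  assumes fin: "finite V" and st: "strong_on V E" and irr: "irrefl E" and x: "x \<in> V"
  shows "card (critical_verts V E - {x}) + (card (in_nbrs V E x) + card (out_nbrs V E x))
    \<le> 2 * (card V - 1)"
proof -
  obtain T where T: "finite T" "card T \<le> card {u \<in> V - {x}. (u, x) \<notin> E}"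
    "\<forall>y v. y \<notin> T \<longrightarrow> y \<noteq> x \<longrightarrow> v \<in> V - {y} \<longrightarrow> (v, x) \<in> (Restr E (V - {y}))\<^sup>*"
    using in_tree[OF fin st x] by (elim exE conjE) (rule that)
  have st': "strong_on V (E\<inverse>)" using st by (simp add: strong_on_converse)
  obtain T' where T': "finite T'" "card T' \<le> card {u \<in> V - {x}. (u, x) \<notin> E\<inverse>}"
    "\<forall>y v. y \<notin> T' \<longrightarrow> y \<noteq> x \<longrightarrow> v \<in> V - {y} \<longrightarrow> (v, x) \<in> (Restr (E\<inverse>) (V - {y}))\<^sup>*"
    using in_tree[OF fin st' x] by (elim exE conjE) (rule that)
  have conv: "Restr (E\<inverse>) W = (Restr E W)\<inverse>" for W by auto
  have "critical_verts V E - {x} \<subseteq> T \<union> T'"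
  proof
    fix y assume y: "y \<in> critical_verts V E - {x}"
    show "y \<in> T \<union> T'"
    proof (rule ccontr)
      assume n: "y \<notin> T \<union> T'"
      have "strong_on (V - {y}) E"
      proof (rule strong_onI[of x])
        fix v assume v: "v \<in> V - {y}"
        show "(v, x) \<in> (Restr E (V - {y}))\<^sup>*" using T(3) n y v by blast
        have "(v, x) \<in> (Restr (E\<inverse>) (V - {y}))\<^sup>*" using T'(3) n y v by blast
        then show "(x, v) \<in> (Restr E (V - {y}))\<^sup>*"
          unfolding conv rtrancl_converse by (rule converseD)
      qed (use x y in auto)
      then show False using y by (auto simp: critical_verts_def)
    qed
  qed
  then have 1: "card (critical_verts V E - {x}) \<le> card T + card T'"
    using T(1) T'(1) by (meson card_Un_le card_mono finite_UnI le_trans)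
  have "card (V - {x}) = card ({u \<in> V - {x}. (u, x) \<notin> E} \<union> in_nbrs V E x)"
    by (rule arg_cong[where f = card]) (use irr in \<open>auto simp: in_nbrs_def irrefl_def\<close>)
  also have "\<dots> = card {u \<in> V - {x}. (u, x) \<notin> E} + card (in_nbrs V E x)"
    by (rule card_Un_disjoint) (use fin in \<open>auto simp: in_nbrs_def\<close>)
  finally have 2: "card (V - {x}) = card {u \<in> V - {x}. (u, x) \<notin> E} + card (in_nbrs V E x)" .
  have "card (V - {x}) = card ({u \<in> V - {x}. (u, x) \<notin> E\<inverse>} \<union> out_nbrs V E x)"
    by (rule arg_cong[where f = card]) (use irr in \<open>auto simp: out_nbrs_def irrefl_def\<close>)
  also have "\<dots> = card {u \<in> V - {x}. (u, x) \<notin> E\<inverse>} + card (out_nbrs V E x)"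
    by (rule card_Un_disjoint) (use fin in \<open>auto simp: out_nbrs_def\<close>)
  finally have 3: "card (V - {x}) = card {u \<in> V - {x}. (u, x) \<notin> E\<inverse>} + card (out_nbrs V E x)" .
  show ?thesis using 1 2 3 T(2) T'(2) x fin by simp
qed

lemma card_Restr_out: "finite V \<Longrightarrow> card (Restr E V) = (\<Sum>x\<in>V. card (out_nbrs V E x))"
proof -
  assume fin: "finite V"
  have "Restr E V = (SIGMA x:V. out_nbrs V E x)" by (auto simp: out_nbrs_def)
  then show ?thesis using fin by (simp add: out_nbrs_def)
qed

lemma card_Restr_in: "finite V \<Longrightarrow> card (Restr E V) = (\<Sum>x\<in>V. card (in_nbrs V E x))"
proof -
  assume fin: "finite V"
  have "(Restr E V)\<inverse> = Restr (E\<inverse>) V" by auto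
  then have "card (Restr E V) = card (Restr (E\<inverse>) V)" by (metis card_inverse)
  also have "\<dots> = (\<Sum>x\<in>V. card (out_nbrs V (E\<inverse>) x))" using fin by (rule card_Restr_out)
  finally show ?thesis by (simp add: out_nbrs_def in_nbrs_def)
qed

text \<open>The degree bound summed over all \<open>x\<close> in \<open>V\<close>; in-degrees and
  out-degrees each add up to the number of edges.\<close>

lemma card_Restr_le_noncritical:
  assumes fin: "finite V" and st: "strong_on V E" and irr: "irrefl E"
  defines "N \<equiv> V - critical_verts V E"
  shows "2 * card (Restr E V) + card N + card V \<le> card V * (card V + card N)"
proof -
  let ?d = "\<lambda>x. card (in_nbrs V E x) + card (out_nbrs V E x)"
  \<comment> \<open>Rearranged degree bound, with the critical vertices counted as
    \<open>card V - card N\<close>. Removing \<open>x\<close> from them lowers the count only if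
    \<open>x\<close> is critical, hence the indicator of \<open>N\<close>.\<close>
  have deg: "?d x + (if x \<in> N then 1 else 0) + 1 \<le> card V + card N" if x: "x \<in> V" for x
  proof -
    have sub: "critical_verts V E \<subseteq> V" by (auto simp: critical_verts_def)
    then have finC: "finite (critical_verts V E)" using fin finite_subset by blast
    have N: "card N = card V - card (critical_verts V E)" "card (critical_verts V E) \<le> card V"
      unfolding N_def using card_Diff_subset[OF finC sub] card_mono[OF fin sub] by auto
    have C: "card (critical_verts V E - {x}) = card (critical_verts V E) - (if x \<in> N then 0 else 1)"
      using x by (auto simp: N_def)
    have "x \<notin> N \<Longrightarrow> card (critical_verts V E) > 0"
      using x finC by (auto simp: N_def card_gt_0_iff)
    moreover have "card V > 0" using x fin by (auto simp: card_gt_0_iff)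
    ultimately show ?thesis using card_critical_degree[OF fin st irr x] N C
      by (auto split: if_splits)
  qed
  have "(\<Sum>x\<in>V. ?d x + (if x \<in> N then 1 else 0) + 1) \<le> (\<Sum>x\<in>V. card V + card N)"
    using deg by (rule sum_mono)
  moreover have "(\<Sum>x\<in>V. if x \<in> N then 1 else 0::nat) = card N"
    using fin by (simp add: N_def sum.If_cases Diff_eq Compl_eq)
  ultimately show ?thesis
    using card_Restr_out[OF fin, of E] card_Restr_in[OF fin, of E]
    by (simp only: sum.distrib sum_constant) (simp add: algebra_simps)
qed

section \<open>Arithmetic of binomial coefficients\<close>

lemma choose_two_Suc: "Suc m choose 2 = m + (m choose 2)"
  by (simp add: numeral_2_eq_2)

lemma choose_two_double: "2 * (m choose 2) + m = m * m"
  by (induction m) (auto simp: choose_two_Suc)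

lemma choose_two_add: "m + k choose 2 = (m choose 2) + (k choose 2) + m * k"
  by (induction k) (auto simp: choose_two_Suc)

lemma sum_lessThan_choose_two: "(\<Sum>i<k. i) = k choose 2"
  by (induction k) (auto simp: choose_two_Suc)

section \<open>At most one noncritical vertex\<close>

lemma strong_on_insert:
  assumes "strong_on S E" "a \<in> S" "(a, x) \<in> E" "b \<in> S" "(x, b) \<in> E"
  shows "strong_on (insert x S) E"
proof (rule strong_onI[of x])
  let ?R = "Restr E (insert x S)"
  have mono: "(u, v) \<in> ?R\<^sup>*" if "u \<in> S" "v \<in> S" for u v
    using rtrancl_Restr_mono[OF strong_onD[OF assms(1) that], of "insert x S"] by auto
  have ax: "(a, x) \<in> ?R" and xb: "(x, b) \<in> ?R" using assms by auto
  fix v assume v: "v \<in> insert x S"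
  show "(v, x) \<in> ?R\<^sup>*"
    using v mono[OF _ assms(2)] ax by (cases "v = x") (auto intro: rtrancl_into_rtrancl)
  show "(x, v) \<in> ?R\<^sup>*"
    using v mono[OF assms(4)] xb by (cases "v = x") (auto intro: converse_rtrancl_into_rtrancl)
qed simp

lemma card_Restr_insert:
  assumes "finite S" "x \<notin> S" "irrefl E"
  shows "card (Restr E (insert x S)) =
    card (Restr E S) + card (in_nbrs S E x) + card (out_nbrs S E x)"
proof -
  let ?A = "in_nbrs S E x \<times> {x}" and ?B = "{x} \<times> out_nbrs S E x"
  have *: "Restr E (insert x S) = Restr E S \<union> ?A \<union> ?B"
    using assms(3) by (auto simp: in_nbrs_def out_nbrs_def irrefl_def)
  have "finite (in_nbrs S E x)" "finite (out_nbrs S E x)"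
    using assms(1) by (auto simp: in_nbrs_def out_nbrs_def)
  moreover have "(Restr E S \<union> ?A) \<inter> ?B = {}" "Restr E S \<inter> ?A = {}"
    using assms(2) by (auto simp: in_nbrs_def out_nbrs_def)
  ultimately show ?thesis
    using assms(1) unfolding * by (simp add: card_Un_disjoint card_cartesian_product)
qed

text \<open>Induction by deleting \<open>x\<close>. If \<open>x\<close> is critical as well, the
  averaged bound suffices. Otherwise the remaining set \<open>S\<close> is strong and has at most
  two noncritical vertices, each being the only in-neighbour or the only out-neighbour of
  \<open>x\<close>.\<close>

lemma card_Restr_one_noncritical:
  assumes "finite V" "strong_on V E" "irrefl E" "x \<in> V" "V - {x} \<subseteq> critical_verts V E"
  shows "card (Restr E V) \<le> (card V choose 2) + 1"
  using assms
proof (induction "card V" arbitrary: V x)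
  case 0
  then show ?case by auto
next
  case (Suc m)
  show ?case
  proof (cases "x \<in> critical_verts V E")
    case True
    then have "V - critical_verts V E = {}" using Suc.prems by auto
    then show ?thesis
      using card_Restr_le_noncritical[OF Suc.prems(1-3)] choose_two_double[of "card V"]
      by (simp only: card.empty add_0_right)
  next
    case False
    define S where "S = V - {x}"
    have S: "finite S" "card S = m" "x \<notin> S" "V = insert x S" "strong_on S E"
      using Suc.hyps Suc.prems False by (auto simp: S_def critical_verts_def)
    then have S0: "S \<noteq> {}" by (auto simp: strong_on_def)
    let ?A = "in_nbrs S E x" and ?B = "out_nbrs S E x"
    have e: "card (Restr E V) = card (Restr E S) + card ?A + card ?B"
      unfolding S(4) using S(1,3) Suc.prems(3) by (rule card_Restr_insert)
    have nb: "in_nbrs V E x = ?A" "out_nbrs V E x = ?B"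
      using Suc.prems(3) by (auto simp: S_def in_nbrs_def out_nbrs_def irrefl_def)
    have crit: "critical_verts V E - {x} = S"
      using Suc.prems(5) by (auto simp: S_def critical_verts_def)
    \<comment> \<open>All \<open>m\<close> vertices of \<open>S\<close> are critical in
      \<open>V\<close>, which leaves \<open>m\<close> of the bound \<open>2 * m\<close> for the
      degree of \<open>x\<close>.\<close>
    have deg: "card ?A + card ?B \<le> m"
      using card_critical_degree[OF Suc.prems(1-4)] S(2) Suc.hyps(2)
      unfolding nb crit by linarith
    have "S \<subseteq> V" "S \<noteq> V" "V - S = {x}" using S by auto
    then have A0: "?A \<noteq> {}"
      using strong_on_exit[OF Suc.prems(2), of S] S0 by (auto simp: in_nbrs_def)
    have "{x} \<subseteq> V" "{x} \<noteq> V" "V - {x} = S" using S S0 by auto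
    then have B0: "?B \<noteq> {}"
      using strong_on_exit[OF Suc.prems(2), of "{x}"] by (auto simp: out_nbrs_def)
    \<comment> \<open>Otherwise \<open>x\<close> keeps an in-neighbour and an out-neighbour in the
      strong set \<open>S - {y}\<close>, so \<open>V - {y}\<close> would be strong.\<close>
    have single: "?A = {y} \<or> ?B = {y}" if y: "y \<in> S - critical_verts S E" for y
    proof (rule ccontr)
      assume n: "\<not> ?thesis"
      obtain a where a: "a \<in> S - {y}" "(a, x) \<in> E"
        using n A0 by (auto simp: in_nbrs_def)
      obtain b where b: "b \<in> S - {y}" "(x, b) \<in> E"
        using n B0 by (auto simp: out_nbrs_def)
      have "strong_on (S - {y}) E" using y by (auto simp: critical_verts_def)
      then have "strong_on (insert x (S - {y})) E" using a b by (rule strong_on_insert)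
      moreover have "insert x (S - {y}) = V - {y}" using S y by auto
      moreover have "y \<in> critical_verts V E" using Suc.prems(5) S y by auto
      ultimately show False by (simp add: critical_verts_def)
    qed
    have eV: "card V choose 2 = m + (m choose 2)"
      using Suc.hyps(2)[symmetric] by (simp add: choose_two_Suc)
    show ?thesis
    \<comment> \<open>Either at most one vertex of \<open>S\<close> is noncritical, and induction
      applies to \<open>S\<close>, or there are two and averaging over \<open>S\<close> takes
      over.\<close>
    proof (cases "\<exists>z\<in>S. S - {z} \<subseteq> critical_verts S E")
      case True
      then obtain z where "z \<in> S" "S - {z} \<subseteq> critical_verts S E" by blast
      then have "card (Restr E S) \<le> (card S choose 2) + 1"
        using Suc.hyps(1)[of S z] S Suc.prems(3) by simp
      then show ?thesis using e deg eV S(2) by simp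
    next
      case False
      obtain y where y: "y \<in> S - critical_verts S E" using False S0 by blast
      obtain z where z: "z \<in> S - critical_verts S E" "z \<noteq> y" using False y by blast
      have sub: "S - critical_verts S E = {y, z}"
      proof
        show "S - critical_verts S E \<subseteq> {y, z}"
        proof
          fix w assume "w \<in> S - critical_verts S E"
          then show "w \<in> {y, z}" using single[of w] single[OF y] single[OF z(1)] z(2) by auto
        qed
      qed (use y z in simp)
      \<comment> \<open>Distinct \<open>y\<close> and \<open>z\<close> cannot be the sole neighbour
        on the same side, so one is the sole in-neighbour and the other the sole out-neighbour.
        Degree 2 at \<open>x\<close> makes up for the weaker bound on \<open>S\<close>.\<close>
      have "card ?A = 1" "card ?B = 1"
        using single[OF y] single[OF z(1)] z(2) by auto
      moreover have "2 * card (Restr E S) + 2 + m \<le> m * (m + 2)"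
        using card_Restr_le_noncritical[OF S(1,5) Suc.prems(3)] sub z(2) S(2) by simp
      ultimately show ?thesis using e eV choose_two_double[of m] by (simp add: algebra_simps)
    qed
  qed
qed

section \<open>Shortest ears\<close>

text \<open>The list holds only the inner vertices. The two attachment vertices in \<open>S\<close>
  may coincide, and repetitions are excluded only later, by minimal length.\<close>

definition ear :: "'a set \<Rightarrow> 'a set \<Rightarrow> 'a rel \<Rightarrow> 'a list \<Rightarrow> bool" where
  "ear S T E ps \<longleftrightarrow> ps \<noteq> [] \<and> set ps \<subseteq> T \<and> successively (\<lambda>a b. (a, b) \<in> E) ps \<and>
     (\<exists>s\<in>S. (s, hd ps) \<in> E) \<and> (\<exists>t\<in>S. (last ps, t) \<in> E)"

lemma successively_rtrancl:
  assumes "successively (\<lambda>a b. (a, b) \<in> E) ps" "set ps \<subseteq> W" "p \<in> set ps"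
  shows "(hd ps, p) \<in> (Restr E W)\<^sup>*" "(p, last ps) \<in> (Restr E W)\<^sup>*"
proof -
  have "(hd ps, p) \<in> (Restr E W)\<^sup>* \<and> (p, last ps) \<in> (Restr E W)\<^sup>*"
    using assms
  proof (induction ps arbitrary: p)
    case (Cons q qs)
    show ?case
    proof (cases "qs = []")
      case True
      then show ?thesis using Cons.prems by simp
    next
      case False
      have step: "(q, hd qs) \<in> Restr E W" and suc: "successively (\<lambda>a b. (a, b) \<in> E) qs"
        using Cons.prems False by (auto simp: successively_Cons)
      have IH: "(hd qs, r) \<in> (Restr E W)\<^sup>*" "(r, last qs) \<in> (Restr E W)\<^sup>*" if "r \<in> set qs" for r
        using Cons.IH[OF suc _ that] Cons.prems by auto
      show ?thesis
        using Cons.prems(3) IH IH(2)[of "hd qs"] step False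
        by (auto intro: converse_rtrancl_into_rtrancl)
    qed
  qed simp
  then show "(hd ps, p) \<in> (Restr E W)\<^sup>*" "(p, last ps) \<in> (Restr E W)\<^sup>*" by auto
qed

lemma strong_on_ear:
  assumes "strong_on S E" "ear S T E ps"
  shows "strong_on (S \<union> set ps) E"
proof -
  let ?W = "S \<union> set ps"
  obtain s t where st: "s \<in> S" "(s, hd ps) \<in> E" "t \<in> S" "(last ps, t) \<in> E"
    and ps: "ps \<noteq> []" "successively (\<lambda>a b. (a, b) \<in> E) ps"
    using assms(2) by (auto simp: ear_def)
  have S: "(u, v) \<in> (Restr E ?W)\<^sup>*" if "u \<in> S" "v \<in> S" for u v
    using rtrancl_Restr_mono[OF strong_onD[OF assms(1) that], of ?W] by auto
  have sh: "(s, hd ps) \<in> Restr E ?W" "(last ps, t) \<in> Restr E ?W" using st ps(1) by auto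
  note P = successively_rtrancl[OF ps(2), of ?W]
  have P1: "(s, p) \<in> (Restr E ?W)\<^sup>*" if "p \<in> set ps" for p
    using P(1)[OF _ that] sh(1) by (auto intro: converse_rtrancl_into_rtrancl)
  have P2: "(p, s) \<in> (Restr E ?W)\<^sup>*" if "p \<in> set ps" for p
    using rtrancl_trans[OF rtrancl_into_rtrancl[OF P(2)[OF _ that] sh(2)] S[OF st(3,1)]] by simp
  show ?thesis
    by (rule strong_onI[of s]) (use S P1 P2 st in auto)
qed

lemma strong_on_cycle:
  assumes "successively (\<lambda>a b. (a, b) \<in> E) ps" "ps \<noteq> []" "(last ps, hd ps) \<in> E"
  shows "strong_on (set ps) E"
proof (rule strong_onI[of "hd ps"])
  fix v assume v: "v \<in> set ps"
  have "(last ps, hd ps) \<in> Restr E (set ps)" using assms by auto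
  then show "(v, hd ps) \<in> (Restr E (set ps))\<^sup>*"
    using successively_rtrancl(2)[OF assms(1) order_refl v] by (rule rtrancl_into_rtrancl[rotated])
  show "(hd ps, v) \<in> (Restr E (set ps))\<^sup>*"
    using successively_rtrancl(1)[OF assms(1) order_refl v] .
qed (use assms in simp)

text \<open>Leave \<open>S\<close> by an edge and follow a path back until its first return to
  \<open>S\<close>.\<close>

lemma ear_exists:
  assumes "strong_on V E" "S \<subseteq> V" "S \<noteq> {}" "S \<noteq> V"
  shows "\<exists>ps. ear S (V - S) E ps"
proof -
  obtain s b where sb: "s \<in> S" "b \<in> V - S" "(s, b) \<in> E" using strong_on_exit[OF assms] by blast
  have "(b, s) \<in> (Restr E V)\<^sup>*" using strong_onD[OF assms(1)] sb assms(2) by auto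
  then have "b \<in> V - S \<Longrightarrow> \<exists>ps. ps \<noteq> [] \<and> hd ps = b \<and> set ps \<subseteq> V - S \<and>
      successively (\<lambda>a b. (a, b) \<in> E) ps \<and> (\<exists>t\<in>S. (last ps, t) \<in> E)"
  proof (induction rule: converse_rtrancl_induct)
    case base
    then show ?case using sb by simp
  next
    case (step b c)
    show ?case
    proof (cases "c \<in> S")
      case True
      then show ?thesis using step by (intro exI[of _ "[b]"]) auto
    next
      case False
      then have "c \<in> V - S" using step by auto
      then obtain ps where "ps \<noteq> []" "hd ps = c" "set ps \<subseteq> V - S"
        "successively (\<lambda>a b. (a, b) \<in> E) ps" "\<exists>t\<in>S. (last ps, t) \<in> E"
        using step.IH by blast
      then show ?thesis using step by (intro exI[of _ "b # ps"]) (auto simp: successively_Cons)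
    qed
  qed
  then show ?thesis using sb unfolding ear_def by metis
qed

text \<open>Each violation yields a shorter ear: a suffix, a prefix, or the list with a segment cut
  out. Backward edges remain unrestricted.\<close>

lemma shortest_ear:
  assumes "ear S T E ps" "\<And>qs. ear S T E qs \<Longrightarrow> length ps \<le> length qs"
  shows "distinct ps"
    and "\<And>s i. s \<in> S \<Longrightarrow> i < length ps \<Longrightarrow> (s, ps ! i) \<in> E \<Longrightarrow> i = 0"
    and "\<And>t i. t \<in> S \<Longrightarrow> i < length ps \<Longrightarrow> (ps ! i, t) \<in> E \<Longrightarrow> Suc i = length ps"
    and "\<And>i j. i < length ps \<Longrightarrow> j < length ps \<Longrightarrow> (ps ! i, ps ! j) \<in> E \<Longrightarrow> j \<le> Suc i"
proof -
  let ?P = "\<lambda>a b. (a, b) \<in> E"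
  have ne: "ps \<noteq> []" and sub: "set ps \<subseteq> T" and suc: "successively ?P ps"
    and s0: "\<exists>s\<in>S. (s, hd ps) \<in> E" and t0: "\<exists>t\<in>S. (last ps, t) \<in> E"
    using assms(1) by (auto simp: ear_def)
  have tk: "successively ?P (take i ps)" and dr: "successively ?P (drop i ps)" for i
    using suc append_take_drop_id[of i ps] by (metis successively_append_iff)+
  have subs: "set (take i ps) \<subseteq> T" "set (drop i ps) \<subseteq> T" for i
    using sub set_take_subset[of i ps] set_drop_subset[of i ps] by auto
  show start: "i = 0" if "s \<in> S" "i < length ps" "(s, ps ! i) \<in> E" for s i
  proof -
    have "ear S T E (drop i ps)"
      using that dr subs t0 by (auto simp: ear_def hd_drop_conv_nth)
    then show ?thesis using assms(2) that(2) by fastforce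
  qed
  show "Suc i = length ps" if "t \<in> S" "i < length ps" "(ps ! i, t) \<in> E" for t i
  proof -
    have "last (take (Suc i) ps) = ps ! i" using that by (simp add: take_Suc_conv_app_nth)
    then have "ear S T E (take (Suc i) ps)"
      using that tk subs s0 ne by (auto simp: ear_def)
    then show ?thesis using assms(2) that(2) by fastforce
  qed
  show shortcut: "j \<le> Suc i" if "i < length ps" "j < length ps" "(ps ! i, ps ! j) \<in> E" for i j
  proof (rule ccontr)
    assume n: "\<not> j \<le> Suc i"
    let ?q = "take (Suc i) ps @ drop j ps"
    have "last (take (Suc i) ps) = ps ! i" using that by (simp add: take_Suc_conv_app_nth)
    then have "successively ?P ?q"
      using that tk dr by (simp add: successively_append_iff hd_drop_conv_nth)
    then have "ear S T E ?q"
      using that subs[of "Suc i"] subs[of j] s0 t0 ne by (auto simp: ear_def)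
    then show False using assms(2)[of ?q] n that by simp
  qed
  show "distinct ps"
  proof (rule ccontr)
    assume "\<not> distinct ps"
    then obtain i j where ij: "i < j" "j < length ps" "ps ! i = ps ! j"
      unfolding distinct_conv_nth by (metis linorder_neqE_nat)
    show False
    \<comment> \<open>The predecessor of the first occurrence, in \<open>S\<close> or on the ear,
      also has an edge to the second one, which is a forbidden jump.\<close>
    proof (cases i)
      case 0
      then have "\<exists>s\<in>S. (s, ps ! j) \<in> E" using s0 ij ne by (simp add: hd_conv_nth)
      then show False using start[of _ j] ij by auto
    next
      case (Suc l)
      then have "(ps ! l, ps ! j) \<in> E" using suc ij Suc by (simp add: successively_conv_nth flip: ij(3))
      then show False using shortcut[of l j] ij Suc by simp
    qed
  qed
qed

text \<open>A walk in the digraph with the ear contracted to \<open>hd ps\<close> lifts to a walk in the digraph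
  itself if every visit of \<open>hd ps\<close> is lifted to \<open>last ps\<close>.\<close>
lemma strong_on_uncontract_ear:
  assumes ps: "ps \<noteq> []" "successively (\<lambda>a b. (a, b) \<in> E) ps" "set ps \<inter> S = {}" and S: "S \<noteq> {}"
    and st: "strong_on (insert (hd ps) S) E'"
    and E': "E' = Restr E S \<union> in_nbrs S E (hd ps) \<times> {hd ps} \<union> {hd ps} \<times> out_nbrs S E (last ps)"
  shows "strong_on (S \<union> set ps) E"
proof -
  let ?W = "S \<union> set ps" and ?p = "hd ps"
  define f where "f u = (if u = ?p then last ps else u)" for u
  have p: "?p \<in> set ps" "last ps \<in> set ps" "?p \<notin> S"
    using ps(3) hd_in_set[OF ps(1)] last_in_set[OF ps(1)] by blast+
  note P = successively_rtrancl[OF ps(2), of ?W]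
  have edge: "(f u, f v) \<in> (Restr E ?W)\<^sup>*" if uv: "(u, v) \<in> E'" for u v
  proof -
    consider "(u, v) \<in> Restr E S" | "u \<in> S" "(u, ?p) \<in> E" "v = ?p" | "u = ?p" "v \<in> S" "(last ps, v) \<in> E"
      using uv by (auto simp: E' in_nbrs_def out_nbrs_def)
    then show ?thesis
    proof cases
      case 1
      then show ?thesis using p by (auto simp: f_def)
    next
      case 2
      then have "(u, ?p) \<in> Restr E ?W" "f u = u" "f v = last ps" using p by (auto simp: f_def)
      then show ?thesis using P(1)[of "last ps"] p by (auto intro: converse_rtrancl_into_rtrancl)
    next
      case 3
      then show ?thesis using p by (auto simp: f_def)
    qed
  qed
  have lift: "(f u, f v) \<in> (Restr E ?W)\<^sup>*" if "u \<in> insert ?p S" "v \<in> insert ?p S" for u v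
    using strong_onD[OF st that]
  proof (induction rule: rtrancl_induct)
    case (step v w)
    then show ?case using edge[of v w] by (auto intro: rtrancl_trans)
  qed simp
  have fS: "f u = u" if "u \<in> S" for u using that p by (auto simp: f_def)
  have fp: "f ?p = last ps" by (simp add: f_def)
  \<comment> \<open>Since \<open>S\<close> is nonempty, some edge of the contracted digraph enters
    \<open>?p\<close>. Lifting a walk from \<open>?p\<close> to its tail shows that the end of the
    ear reaches the start.\<close>
  obtain a where a: "a \<in> S" "(a, ?p) \<in> E"
    using strong_on_exit[OF st, of S] S p by (auto simp: E' in_nbrs_def)
  have la: "(last ps, ?p) \<in> (Restr E ?W)\<^sup>*"
    using lift[of ?p a] fS[OF a(1)] fp a p by (auto intro: rtrancl_into_rtrancl)
  show ?thesis
  proof (rule strong_onI[of "last ps"])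
    fix v assume v: "v \<in> ?W"
    show "(v, last ps) \<in> (Restr E ?W)\<^sup>*"
      using v lift[of v ?p] fS fp P(2) by auto
    show "(last ps, v) \<in> (Restr E ?W)\<^sup>*"
      using v lift[of ?p v] fS fp P(1)[of v] la by (auto intro: rtrancl_trans)
  qed (use p in simp)
qed

section \<open>The upper bound\<close>

text \<open>The index pairs that edges of a shortest ear can occupy: backward ones and consecutive
  forward ones.\<close>

lemma card_index_le: "card {(i, j). i < k \<and> j < k \<and> j \<le> Suc i \<and> i \<noteq> j} \<le> (k choose 2) + (k - 1)"
proof -
  let ?I = "SIGMA i:{..<k}. {..<i}" and ?J = "(\<lambda>i. (i, Suc i)) ` {..<k - 1}"
  have "{(i, j). i < k \<and> j < k \<and> j \<le> Suc i \<and> i \<noteq> j} \<subseteq> ?I \<union> ?J"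
  proof
    fix e assume "e \<in> {(i, j). i < k \<and> j < k \<and> j \<le> Suc i \<and> i \<noteq> j}"
    then obtain i j where "e = (i, j)" "i < k" "j < k" "j \<le> Suc i" "i \<noteq> j" by auto
    then show "e \<in> ?I \<union> ?J" by (cases "j < i") auto
  qed
  then have "card {(i, j). i < k \<and> j < k \<and> j \<le> Suc i \<and> i \<noteq> j} \<le> card ?I + card ?J"
    by (meson card_Un_le card_mono finite_SigmaI finite_UnI finite_imageI finite_lessThan le_trans)
  also have "card ?I = k choose 2" by (simp add: sum_lessThan_choose_two)
  also have "card ?J \<le> k - 1" using card_image_le[of "{..<k - 1}"] by simp
  finally show ?thesis by simp
qed

text \<open>The upper bound for relations, in additive form to avoid truncated subtraction.\<close>

lemma card_Restr_critical_le:
  assumes fin: "finite V" and st: "strong_on V E" and irr: "irrefl E"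
    and crit: "critical_verts V E = V" and n4: "card V \<ge> 4"
  shows "card (Restr E V) + card V \<le> (card V choose 2) + 4"
proof -
  define P where "P S \<longleftrightarrow> S \<subset> V \<and> strong_on S E" for S
  obtain v where v: "v \<in> V" using st by (auto simp: strong_on_def)
  have "P {v}" using v n4 by (auto simp: P_def strong_on_def)
  moreover have "card S < Suc (card V)" if "P S" for S
    using that fin by (simp add: P_def psubset_card_mono less_SucI)
  ultimately obtain S where "P S" and maxS: "\<And>S'. P S' \<Longrightarrow> card S' \<le> card S"
    using ex_has_greatest_nat[of P "{v}" card "Suc (card V)"] by blast
  then have S: "S \<subset> V" "strong_on S E" "S \<noteq> {}" by (auto simp: P_def strong_on_def)
  then have finS: "finite S" using fin finite_subset by blast
  have "\<exists>ps. ear S (V - S) E ps" using ear_exists[OF st] S by blast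
  then obtain ps where ps: "ear S (V - S) E ps"
    and short: "\<And>qs. ear S (V - S) E qs \<Longrightarrow> length ps \<le> length qs"
    using ex_has_least_nat[of "ear S (V - S) E" _ length] by blast
  note shortest = shortest_ear[OF ps short]
  have ne: "ps \<noteq> []" and sub: "set ps \<subseteq> V - S"
    and suc: "successively (\<lambda>a b. (a, b) \<in> E) ps"
    and s0: "\<exists>s\<in>S. (s, hd ps) \<in> E" and t0: "\<exists>t\<in>S. (last ps, t) \<in> E"
    using ps by (auto simp: ear_def)
  have V: "S \<union> set ps = V"
  proof (rule ccontr)
    assume "S \<union> set ps \<noteq> V"
    then have "P (S \<union> set ps)" using strong_on_ear[OF S(2) ps] S(1) sub by (auto simp: P_def)
    then have "card (S \<union> set ps) \<le> card S" by (rule maxS)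
    moreover have "card (S \<union> set ps) = card S + card (set ps)"
      by (rule card_Un_disjoint) (use finS sub in auto)
    ultimately show False using ne by simp
  qed
  define k where "k = length ps"
  define s where "s = card S"
  have dist: "distinct ps" using shortest(1) .
  have disj: "S \<inter> set ps = {}" using sub by auto
  have n: "card V = s + k"
    using card_Un_disjoint[OF finS _ disj] distinct_card[OF dist] V by (simp add: s_def k_def)
  have s1: "s \<ge> 1" using S(3) finS by (simp add: s_def Suc_le_eq card_gt_0_iff)
  let ?p = "hd ps" and ?q = "last ps"
  \<comment> \<open>With a single ear vertex \<open>p\<close>, the set \<open>V - {p}\<close> would
    be the strong set \<open>S\<close>.\<close>
  have k2: "k \<ge> 2"
  proof (rule ccontr)
    assume "\<not> k \<ge> 2"
    moreover have "length ps \<noteq> 0" using ne by simp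
    ultimately have "length ps = Suc 0" unfolding k_def by linarith
    then obtain p where "ps = [p]" by (auto simp: length_Suc_conv)
    then have "V - {p} = S" "p \<in> V" using V disj by auto
    then show False using crit S(2) by (auto simp: critical_verts_def)
  qed
  let ?A = "in_nbrs S E ?p" and ?B = "out_nbrs S E ?q"
  have fAB: "finite ?A" "finite ?B" using finS by (auto simp: in_nbrs_def out_nbrs_def)
  have "Restr E V \<subseteq> Restr E S \<union> Restr E (set ps) \<union> ?A \<times> {?p} \<union> {?q} \<times> ?B"
  proof
    fix e assume "e \<in> Restr E V"
    then obtain a b where e: "e = (a, b)" "(a, b) \<in> E" "a \<in> S \<union> set ps" "b \<in> S \<union> set ps"
      using V by auto
    consider "a \<in> S" "b \<in> S" | "a \<in> set ps" "b \<in> set ps" | "a \<in> S" "b \<in> set ps"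
      | "a \<in> set ps" "b \<in> S" using e by auto
    then show "e \<in> Restr E S \<union> Restr E (set ps) \<union> ?A \<times> {?p} \<union> {?q} \<times> ?B"
    proof cases
      case 3
      then obtain i where "i < length ps" "b = ps ! i" by (auto simp: in_set_conv_nth)
      then have "b = ?p" using shortest(2)[of a i] 3 e ne by (simp add: hd_conv_nth)
      then show ?thesis using 3 e by (auto simp: in_nbrs_def)
    next
      case 4
      then obtain i where "i < length ps" "a = ps ! i" by (auto simp: in_set_conv_nth)
      moreover from this have "i = length ps - 1" using shortest(3)[of b i] 4 e by simp
      ultimately have "a = ?q" using ne by (simp add: last_conv_nth)
      then show ?thesis using 4 e by (auto simp: out_nbrs_def)
    qed (use e in auto)
  qed
  then have "card (Restr E V) \<le> card (Restr E S \<union> Restr E (set ps) \<union> ?A \<times> {?p} \<union> {?q} \<times> ?B)"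
    by (intro card_mono) (use finS fAB in auto)
  also have "\<dots> \<le> card (Restr E S) + card (Restr E (set ps)) + card (?A \<times> {?p}) + card ({?q} \<times> ?B)"
    using card_Un_le[of "Restr E S" "Restr E (set ps)"]
      card_Un_le[of "Restr E S \<union> Restr E (set ps)" "?A \<times> {?p}"]
      card_Un_le[of "Restr E S \<union> Restr E (set ps) \<union> ?A \<times> {?p}" "{?q} \<times> ?B"] by linarith
  finally have e: "card (Restr E V) \<le> card (Restr E S) + card (Restr E (set ps)) + card ?A + card ?B"
    by (simp add: card_cartesian_product)
  let ?nth = "\<lambda>(i, j). (ps ! i, ps ! j)"
  have Eps: "Restr E (set ps) \<subseteq> ?nth ` {(i, j). i < k \<and> j < k \<and> j \<le> Suc i \<and> i \<noteq> j}"
  proof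
    fix e assume "e \<in> Restr E (set ps)"
    then obtain i j where ij: "i < length ps" "j < length ps" "e = (ps ! i, ps ! j)" "e \<in> E"
      by (auto simp: in_set_conv_nth)
    moreover have "i \<noteq> j" using ij irr by (auto simp: irrefl_def)
    ultimately show "e \<in> ?nth ` {(i, j). i < k \<and> j < k \<and> j \<le> Suc i \<and> i \<noteq> j}"
      using shortest(4)[of i j] by (intro image_eqI[of _ _ "(i, j)"]) (auto simp: k_def)
  qed
  show ?thesis
  proof (cases "s = 1")
    case False
    \<comment> \<open>The ear contracted to \<open>?p\<close>: edges into its first vertex and out
      of its last one now meet at \<open>?p\<close>.\<close>
    define E' where "E' = Restr E S \<union> ?A \<times> {?p} \<union> {?p} \<times> ?B"
    have p: "?p \<notin> S" using disj hd_in_set[OF ne] by auto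
    have irr': "irrefl E'" using irr p by (auto simp: E'_def irrefl_def in_nbrs_def out_nbrs_def)
    have RS: "Restr E' S = Restr E S" using p by (auto simp: E'_def)
    have nbS: "in_nbrs S E' ?p = ?A" "out_nbrs S E' ?p = ?B"
      using p by (auto simp: E'_def in_nbrs_def out_nbrs_def)
    have stS: "strong_on S E'" using S(2) unfolding strong_on_def RS .
    have st': "strong_on (insert ?p S) E'"
    proof -
      obtain a b where "a \<in> S" "(a, ?p) \<in> E" "b \<in> S" "(?q, b) \<in> E" using s0 t0 by blast
      then show ?thesis
        by (intro strong_on_insert[OF stS, of a _ b]) (auto simp: E'_def in_nbrs_def out_nbrs_def)
    qed
    have crit': "insert ?p S - {?p} \<subseteq> critical_verts (insert ?p S) E'"
    proof
      fix y assume "y \<in> insert ?p S - {?p}"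
      then have y: "y \<in> S" "y \<noteq> ?p" by auto
      have ins: "insert ?p S - {y} = insert ?p (S - {y})" using y by auto
      have Vy: "S - {y} \<union> set ps = V - {y}" using V disj y(1) by auto
      have "\<not> strong_on (insert ?p (S - {y})) E'"
      proof
        assume strong: "strong_on (insert ?p (S - {y})) E'"
        \<comment> \<open>The contraction formed over \<open>S - {y}\<close>; it agrees with
          \<open>E'\<close> there and has the shape needed for uncontracting.\<close>
        let ?E = "Restr E (S - {y}) \<union> in_nbrs (S - {y}) E ?p \<times> {?p} \<union> {?p} \<times> out_nbrs (S - {y}) E ?q"
        have "Restr E' (insert ?p (S - {y})) = Restr ?E (insert ?p (S - {y}))"
          using p by (auto simp: E'_def in_nbrs_def out_nbrs_def)
        then have *: "strong_on (insert ?p (S - {y})) ?E" using strong unfolding strong_on_def by simp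
        have Sy: "S - {y} \<noteq> {}"
        proof
          assume "S - {y} = {}"
          then have "S = {y}" using y by auto
          then show False using False by (simp add: s_def)
        qed
        have "set ps \<inter> (S - {y}) = {}" using disj by auto
        then have "strong_on (S - {y} \<union> set ps) E"
          using strong_on_uncontract_ear[OF ne suc _ Sy * refl] by simp
        then have "strong_on (V - {y}) E" unfolding Vy .
        moreover have "y \<in> critical_verts V E" using crit y V by auto
        ultimately show False by (simp add: critical_verts_def)
      qed
      then show "y \<in> critical_verts (insert ?p S) E'"
        using y by (simp add: critical_verts_def ins)
    qed
    have "card (Restr E' (insert ?p S)) \<le> (Suc s choose 2) + 1"
      using card_Restr_one_noncritical[OF _ st' irr' _ crit'] finS p by (simp add: s_def)
    then have "card (Restr E S) + card ?A + card ?B \<le> s + (s choose 2) + 1"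
      using card_Restr_insert[OF finS p irr'] by (simp only: RS nbS choose_two_Suc)
    moreover have "card (Restr E (set ps)) \<le> (k choose 2) + (k - 1)"
    proof -
      have "finite {(i, j). i < k \<and> j < k \<and> j \<le> Suc i \<and> i \<noteq> j}"
        by (rule finite_subset[of _ "{..<k} \<times> {..<k}"]) auto
      then show ?thesis using surj_card_le[OF _ Eps] card_index_le[of k] by linarith
    qed
    \<comment> \<open>What remains after expanding \<open>s + k choose 2\<close>, namely that the
      product of \<open>s - 2\<close> and \<open>k - 2\<close> is nonnegative.\<close>
    moreover have "2 * s + 2 * k \<le> s * k + 4"
    proof -
      obtain s' k' where "s = s' + 2" "k = k' + 2"
        using False s1 k2 by (metis One_nat_def Suc_1 Suc_leI add.commute le_Suc_ex le_neq_implies_less)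
      then show ?thesis by (simp add: algebra_simps)
    qed
    ultimately show ?thesis using e k2 unfolding n choose_two_add by linarith
  next
    case True
    have A1: "card ?A \<le> 1" "card ?B \<le> 1"
      using True card_mono[OF finS, of ?A] card_mono[OF finS, of ?B]
      by (auto simp: s_def in_nbrs_def out_nbrs_def)
    obtain z where z: "S = {z}" using True by (auto simp: s_def card_1_singleton_iff)
    have S0: "Restr E S = {}" using irr by (auto simp: z irrefl_def)
    have "Restr E (set ps) \<subseteq> (\<lambda>i. (ps ! i, ps ! Suc i)) ` {..<k - 1}"
    proof
      fix e assume e: "e \<in> Restr E (set ps)"
      then obtain i j where ij: "i < k" "j < k" "j \<le> Suc i" "i \<noteq> j" "e = (ps ! i, ps ! j)"
        using Eps by auto
      \<comment> \<open>A backward edge would close the ear segment from index \<open>j\<close> to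
        \<open>i\<close> into a cycle. Its vertices form a strong set of size at least 2 that avoids
        \<open>S\<close>, against the maximality of the singleton \<open>S\<close>.\<close>
      have "\<not> j < i"
      proof
        assume ji: "j < i"
        define qs where "qs = drop j (take (Suc i) ps)"
        have qne: "qs \<noteq> []" using ij ji by (auto simp: qs_def k_def)
        have "take (Suc i) ps \<noteq> []" using ne by simp
        have hq: "hd qs = ps ! j" using ij ji by (simp add: qs_def k_def hd_drop_conv_nth)
        have lq: "last qs = ps ! i" using ij ji by (simp add: qs_def k_def last_drop take_Suc_conv_app_nth)
        have "successively (\<lambda>a b. (a, b) \<in> E) (take j ps @ qs @ drop (Suc i) ps)"
        proof -
          have "take j ps @ qs = take (Suc i) ps"
            using append_take_drop_id[of j "take (Suc i) ps"] ij ji by (simp add: qs_def min_def)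
          then have "take j ps @ qs @ drop (Suc i) ps = ps"
            by (metis append_assoc append_take_drop_id)
          then show ?thesis using suc by simp
        qed
        then have "successively (\<lambda>a b. (a, b) \<in> E) qs" by (simp add: successively_append_iff)
        then have "strong_on (set qs) E"
          using strong_on_cycle[OF _ qne] e ij(5) hq lq by simp
        moreover have "set qs \<subseteq> set ps"
          unfolding qs_def by (meson order_trans set_drop_subset set_take_subset)
        ultimately have "P (set qs)" using sub S(3) V by (auto simp: P_def)
        then have "card (set qs) \<le> 1" using maxS True by (simp add: s_def)
        moreover have "{ps ! i, ps ! j} \<subseteq> set qs" using hd_in_set[OF qne] last_in_set[OF qne] hq lq by simp
        moreover have "card {ps ! i, ps ! j} = 2"
          using nth_eq_iff_index_eq[OF dist] ij by (simp add: k_def)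
        ultimately show False using card_mono[of "set qs" "{ps ! i, ps ! j}"] by simp
      qed
      then have "j = Suc i" using ij by simp
      then show "e \<in> (\<lambda>i. (ps ! i, ps ! Suc i)) ` {..<k - 1}" using ij by auto
    qed
    then have "card (Restr E (set ps)) \<le> k - 1" using surj_card_le[of "{..<k - 1}"] by fastforce
    then have "card (Restr E V) \<le> card V" using e A1 S0 n True k2 by simp
    moreover have "2 * card V \<le> (card V choose 2) + 4"
    proof -
      obtain m where "card V = m + 4" using n4 by (metis add.commute le_Suc_ex)
      then show ?thesis using choose_two_double[of "card V"] by (simp add: algebra_simps)
    qed
    ultimately show ?thesis by linarith
  qed
qed

section \<open>The extremal digraph\<close>

text \<open>For \<open>n \<ge> 4\<close>, the set \<open>{2..<n}\<close> is strong and
  \<open>[0, 1]\<close> is an ear of it, so \<open>k = 2\<close> and the slack in the upper bound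
  vanishes.\<close>

definition extremal_rel :: "nat \<Rightarrow> nat rel" where
  "extremal_rel n = (\<lambda>i. (i, Suc i)) ` {..<n - 1} \<union> (SIGMA j:{..<n}. {2..<j}) \<union> {(n - 1, 0), (1, 0)}"

lemma extremal_rel_iff:
  "n \<ge> 4 \<Longrightarrow> (a, b) \<in> extremal_rel n \<longleftrightarrow> (b = Suc a \<and> b < n) \<or> (2 \<le> b \<and> b < a \<and> a < n) \<or>
    (b = 0 \<and> (a = n - 1 \<or> a = 1))"
  by (auto simp: extremal_rel_def)

lemma card_extremal_rel:
  assumes "n \<ge> 4"
  shows "card (extremal_rel n) + n = (n choose 2) + 4"
proof -
  let ?I = "(\<lambda>i. (i, Suc i)) ` {..<n - 1}" and ?J = "SIGMA j:{..<n}. {2..<j}"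
  have I: "card ?I = n - 1" by (simp add: card_image inj_on_def)
  \<comment> \<open>Vertex \<open>j\<close> has \<open>j - 2\<close> backward edges into
    \<open>{2..<j}\<close>; truncation gives 0 for \<open>j < 2\<close>.\<close>
  have sum: "(\<Sum>j<Suc (Suc m). j - 2) = m choose 2" for m
    by (induction m) (auto simp: choose_two_Suc)
  have "Suc (Suc (n - 2)) = n" using assms by simp
  then have J: "card ?J = n - 2 choose 2" using sum[of "n - 2"] by (simp only:) simp
  have "card (extremal_rel n) = card (?I \<union> ?J) + card {(n - 1, 0), (1, 0::nat)}"
    unfolding extremal_rel_def by (rule card_Un_disjoint) (use assms in auto)
  also have "card (?I \<union> ?J) = card ?I + card ?J" by (rule card_Un_disjoint) auto
  also have "card {(n - 1, 0), (1, 0::nat)} = 2" using assms by simp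
  finally have *: "card (extremal_rel n) = n - 1 + (n - 2 choose 2) + 2" by (simp only: I J)
  obtain m where "n = Suc (Suc m)" by (rule that[of "n - 2"]) (use assms in simp)
  then show ?thesis using * assms by (simp add: choose_two_Suc)
qed

lemma strong_on_extremal:
  assumes "n \<ge> 4"
  shows "strong_on {..<n} (extremal_rel n)"
proof (rule strong_onI[of 0])
  let ?R = "Restr (extremal_rel n) {..<n}"
  have fw: "(i, j) \<in> ?R\<^sup>*" if "i \<le> j" "j < n" for i j
    using that
  proof (induction j rule: dec_induct)
    case (step j)
    then have "(j, Suc j) \<in> ?R" using assms by (simp add: extremal_rel_iff)
    then show ?case using step by (auto intro: rtrancl_into_rtrancl)
  qed simp
  fix v assume v: "v \<in> {..<n}"
  then show "(0, v) \<in> ?R\<^sup>*" using fw by simp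
  have "(v, n - 1) \<in> ?R\<^sup>*" using fw v by simp
  moreover have "(n - 1, 0) \<in> ?R" using assms by (simp add: extremal_rel_iff)
  ultimately show "(v, 0) \<in> ?R\<^sup>*" by (rule rtrancl_into_rtrancl)
qed (use assms in simp)

lemma critical_verts_extremal:
  assumes "n \<ge> 4"
  shows "critical_verts {..<n} (extremal_rel n) = {..<n}"
proof -
  have "\<not> strong_on ({..<n} - {y}) (extremal_rel n)" if y: "y < n" for y
  proof -
    \<comment> \<open>A set that no edge leaves once \<open>y\<close> is deleted. It misses vertex
      1, vertex 0 or vertex \<open>n - 1\<close>, respectively.\<close>
    define X where "X = (if y = 0 then {2..<n} else if y = n - 1 then {2..<n - 1} else {..<y})"
    have "X \<subseteq> {..<n} - {y}" "X \<noteq> {}" using y assms by (auto simp: X_def split: if_splits)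
    moreover have "X \<noteq> {..<n} - {y}"
    proof -
      define w where "w = (if y = 0 then 1 else if y = n - 1 then 0 else n - 1)"
      have "w \<in> {..<n} - {y}" "w \<notin> X" using y assms by (auto simp: X_def w_def split: if_splits)
      then show ?thesis by blast
    qed
    moreover have "b \<in> X" if "a \<in> X" "b \<in> {..<n} - {y}" "(a, b) \<in> extremal_rel n" for a b
      using that y assms by (auto simp: X_def extremal_rel_iff split: if_splits)
    ultimately show ?thesis using strong_on_exit[of "{..<n} - {y}" "extremal_rel n" X] by blast
  qed
  then show ?thesis by (auto simp: critical_verts_def)
qed

section \<open>Transfer to digraphs\<close>

text \<open>Reachability in digraphs is based on \<open>rtrancl_on\<close>, which is reflexive only
  on \<open>V\<close>; hence the premise on \<open>u\<close>.\<close>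

lemma rtrancl_on_iff_Restr:
  assumes "u \<in> V"
  shows "(u, v) \<in> rtrancl_on V E \<longleftrightarrow> (u, v) \<in> (Restr E V)\<^sup>*"
proof
  assume "(u, v) \<in> rtrancl_on V E"
  then show "(u, v) \<in> (Restr E V)\<^sup>*"
    by (induction rule: rtrancl_on_induct) (auto intro: rtrancl_into_rtrancl)
next
  assume "(u, v) \<in> (Restr E V)\<^sup>*"
  then show "(u, v) \<in> rtrancl_on V E"
    by (induction rule: rtrancl_induct) (use assms in \<open>auto intro: rtrancl_on_into_rtrancl_on\<close>)
qed

lemma strongly_connected_iff_strong_on:
  "strongly_connected D \<longleftrightarrow> strong_on (verts D) (arcs_ends D)"
  unfolding strongly_connected_def strong_on_def reachable_def
  by (auto simp: rtrancl_on_iff_Restr)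

lemma strong_on_Restr: "strong_on V (Restr E V) \<longleftrightarrow> strong_on V E"
  unfolding strong_on_def by (simp add: Int_assoc)

lemma strongly_connected_del_vert:
  assumes "wf_digraph D"
  shows "strongly_connected (pre_digraph.del_vert D v) \<longleftrightarrow> strong_on (verts D - {v}) (arcs_ends D)"
proof -
  interpret wf_digraph D by fact
  have "arcs_ends (pre_digraph.del_vert D v) = Restr (arcs_ends D) (verts D - {v})"
    by (auto simp: arcs_ends_conv del_vert_simps)
  then show ?thesis
    by (simp only: strongly_connected_iff_strong_on verts_del_vert strong_on_Restr)
qed

lemma critical_strongly_connected_iff:
  assumes "wf_digraph D"
  shows "critical_strongly_connected D \<longleftrightarrow>
    strong_on (verts D) (arcs_ends D) \<and> critical_verts (verts D) (arcs_ends D) = verts D"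
  unfolding critical_strongly_connected_def critical_verts_def
  using strongly_connected_del_vert[OF assms] strongly_connected_iff_strong_on[of D] by auto

theorem theorem1:
  fixes n :: nat
  assumes "n \<ge> 4"
  shows "int (M n) = int (n choose 2) - int n + 4"
proof -
  have upper: "k + n \<le> (n choose 2) + 4" if k: "k \<in> critical_arc_counts n" for k
  proof -
    obtain D :: "(nat, nat \<times> nat) pre_digraph" where D: "digraph D"
      "critical_strongly_connected D" "card (verts D) = n" "k = card (arcs D)"
      using k unfolding critical_arc_counts_def by blast
    interpret digraph D by fact
    \<comment> \<open>Without parallel arcs, arcs correspond to their pairs of ends.\<close>
    have "card (arcs_ends D) = k"
      unfolding arcs_ends_def D(4) by (rule card_image[OF inj_on_arc_to_ends])
    moreover have "Restr (arcs_ends D) (verts D) = arcs_ends D"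
      by (auto simp: arcs_ends_conv)
    moreover have "irrefl (arcs_ends D)"
      unfolding irrefl_def using adj_not_same by blast
    ultimately show ?thesis
      using card_Restr_critical_le[OF finite_verts, of "arcs_ends D"] assms D(2,3)
      by (simp add: critical_strongly_connected_iff[OF wf_digraph])
  qed
  define D where "D = \<lparr>verts = {..<n}, arcs = extremal_rel n, tail = fst, head = snd\<rparr>"
  have ends: "arcs_ends D = extremal_rel n" by (simp add: arcs_ends_conv D_def)
  have fin: "finite (extremal_rel n)" by (simp add: extremal_rel_def)
  interpret D: digraph D
    by unfold_locales (use assms fin in \<open>auto simp: D_def extremal_rel_iff arc_to_ends_def\<close>)
  have "critical_strongly_connected D"
    unfolding critical_strongly_connected_iff[OF D.wf_digraph] ends
    using strong_on_extremal[OF assms] critical_verts_extremal[OF assms] by (simp add: D_def)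
  moreover have "card (verts D) = n" by (simp add: D_def)
  ultimately have "card (arcs D) \<in> critical_arc_counts n"
    unfolding critical_arc_counts_def using D.digraph_axioms by blast
  then have mem: "card (extremal_rel n) \<in> critical_arc_counts n" by (simp add: D_def)
  have "M n = card (extremal_rel n)"
    unfolding M_def
  proof (rule Max_eqI[OF finite_critical_arc_counts _ mem])
    fix k assume "k \<in> critical_arc_counts n"
    then show "k \<le> card (extremal_rel n)" using upper card_extremal_rel[OF assms] by force
  qed
  then show ?thesis using card_extremal_rel[OF assms] by simp
qed

end
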